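(* Every abelian topological group is topologically isomorphic to a subgroup (with the subspace topology) of a duoseparable abelian-by-cyclic topological group.
   Context: A topological group $G$ is duoseparable if it contains a countable subset $S$ such that $G=SUS$ for every neighborhood $U\subseteq G$ of the unit, where $AB=\{ab:a\in A,\ b\in B\}$. A topological group $G$ is abelian-by-cyclic if it contains a closed normal abelian subgroup $H$ such that the quotient group $G/H$ is cyclic. *)

theory Defs
  imports
    "HOL-Algebra.Elementary_Groups"
    "HOL-Analysis.Product_Topology"
    "HOL-Library.Countable_Set"
begin

(* Multiplicative groups given by a carrier, with a topology on that carrier.
   No separation axiom is imposed. *)
locale topological_group = group G for G (structure) +
  fixes T :: "'a topology"
  assumes topspace_eq_carrier: "topspace T = carrier G"
    and continuous_mult: "continuous_map (prod_topology T T) T (\<lambda>(x, y). x \<otimes> y)"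
    and continuous_inv: "continuous_map T T (\<lambda>x. inv x)"

(* Neighborhoods need not be open. *)
definition unit_neighborhood :: "('a, 'b) monoid_scheme \<Rightarrow> 'a topology \<Rightarrow> 'a set \<Rightarrow> bool" where
  "unit_neighborhood G T U \<longleftrightarrow> U \<subseteq> carrier G \<and> \<one>\<^bsub>G\<^esub> \<in> T interior_of U"

definition duoseparable :: "('a, 'b) monoid_scheme \<Rightarrow> 'a topology \<Rightarrow> bool" where
  "duoseparable G T \<longleftrightarrow>
    (\<exists>S. S \<subseteq> carrier G \<and> countable S \<and>
      (\<forall>U. unit_neighborhood G T U \<longrightarrow> carrier G = S <#>\<^bsub>G\<^esub> U <#>\<^bsub>G\<^esub> S))"

definition abelian_by_cyclic :: "('a, 'b) monoid_scheme \<Rightarrow> 'a topology \<Rightarrow> bool" where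
  "abelian_by_cyclic G T \<longleftrightarrow>
    (\<exists>H. normal H G \<and> closedin T H \<and> comm_group (G\<lparr>carrier := H\<rparr>) \<and> cyclic_group (G Mod H))"

definition topologically_isomorphic ::
  "('a, 'b) monoid_scheme \<Rightarrow> 'a topology \<Rightarrow> ('c, 'd) monoid_scheme \<Rightarrow> 'c topology \<Rightarrow> bool" where
  "topologically_isomorphic G T K T' \<longleftrightarrow> (\<exists>f. f \<in> iso G K \<and> homeomorphic_map T T' f)"

end

(* G sits as one coordinate of the group D of finitely supported functions from the integers to G,
   with the topology inherited from the product, and the ambient group is the semidirect product
   of D with the discrete group of integers acting by shifts (a restricted wreath product).
   A unit neighborhood U restricts only finitely many coordinates, so every x in D has a shift
   lying in U; as shifting is conjugation by an integer, the countable set of integers already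
   satisfies SUS = everything. *)
theory Submission
  imports Defs
begin

section \<open>The restricted wreath product of a group with the integers, as an abstract
  group\<close>

definition finsupp :: "('a, 'b) monoid_scheme \<Rightarrow> (int \<Rightarrow> 'a) set" where
  "finsupp G = {x. range x \<subseteq> carrier G \<and> finite {i. x i \<noteq> \<one>\<^bsub>G\<^esub>}}"

text \<open>The integer k acts on the base group by sending x to
  \<open>\<lambda>i. x (i - k)\<close>; the minus sign makes this a left action, and the second
  factor is twisted by the integer of the first.\<close>

definition wreath_int :: "('a, 'b) monoid_scheme \<Rightarrow> ((int \<Rightarrow> 'a) \<times> int) monoid" where
  "wreath_int G = \<lparr>carrier = finsupp G \<times> UNIV,
     monoid.mult = (\<lambda>p q. (\<lambda>i. fst p i \<otimes>\<^bsub>G\<^esub> fst q (i - snd p), snd p + snd q)),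
     one = (\<lambda>_. \<one>\<^bsub>G\<^esub>, 0)\<rparr>"

text \<open>The base carries the topology of pointwise convergence, not the box topology, so that
  neighborhoods control only finitely many coordinates. Discreteness of the integers makes the base
  group closed and lets continuity be checked one shift at a time.\<close>

definition wreath_int_topology ::
  "('a, 'b) monoid_scheme \<Rightarrow> 'a topology \<Rightarrow> ((int \<Rightarrow> 'a) \<times> int) topology" where
  "wreath_int_topology G T =
     prod_topology (subtopology (product_topology (\<lambda>_. T) UNIV) (finsupp G)) (discrete_topology UNIV)"

lemma carrier_wreath_int [simp]: "carrier (wreath_int G) = finsupp G \<times> UNIV"
  and mult_wreath_int [simp]:
    "p \<otimes>\<^bsub>wreath_int G\<^esub> q = (\<lambda>i. fst p i \<otimes>\<^bsub>G\<^esub> fst q (i - snd p), snd p + snd q)"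
  and one_wreath_int [simp]: "\<one>\<^bsub>wreath_int G\<^esub> = (\<lambda>_. \<one>\<^bsub>G\<^esub>, 0)"
  by (simp_all add: wreath_int_def)

lemma finsupp_closed: "x \<in> finsupp G \<Longrightarrow> x i \<in> carrier G"
  by (auto simp: finsupp_def)

lemma finsupp_shift:
  assumes "x \<in> finsupp G"
  shows "(\<lambda>i. x (i + k)) \<in> finsupp G"
proof -
  have "{i. x (i + k) \<noteq> \<one>\<^bsub>G\<^esub>} = (\<lambda>i. i - k) ` {i. x i \<noteq> \<one>\<^bsub>G\<^esub>}"
    by (auto simp: image_iff) (metis add_diff_cancel_right')
  then show ?thesis
    using assms by (auto simp: finsupp_def)
qed

context group
begin

lemma finsupp_one: "(\<lambda>_. \<one>) \<in> finsupp G"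
  by (auto simp: finsupp_def)

lemma finsupp_single: "a \<in> carrier G \<Longrightarrow> (\<lambda>i. if i = k then a else \<one>) \<in> finsupp G"
  by (auto simp: finsupp_def intro: finite_subset[of _ "{k}"])

lemma finsupp_mult:
  assumes "x \<in> finsupp G" "y \<in> finsupp G"
  shows "(\<lambda>i. x i \<otimes> y i) \<in> finsupp G"
proof -
  have "{i. x i \<otimes> y i \<noteq> \<one>} \<subseteq> {i. x i \<noteq> \<one>} \<union> {i. y i \<noteq> \<one>}"
    by auto
  then show ?thesis
    using assms by (auto simp: finsupp_def intro: finite_subset intro!: m_closed)
qed

lemma finsupp_inv:
  assumes "x \<in> finsupp G"
  shows "(\<lambda>i. inv (x i)) \<in> finsupp G"
proof -
  have "{i. inv (x i) \<noteq> \<one>} \<subseteq> {i. x i \<noteq> \<one>}"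
    by auto
  then show ?thesis
    using assms by (auto simp: finsupp_def intro: finite_subset intro!: inv_closed)
qed

lemma wreath_int_closed:
  assumes "p \<in> carrier (wreath_int G)" "q \<in> carrier (wreath_int G)"
  shows "p \<otimes>\<^bsub>wreath_int G\<^esub> q \<in> carrier (wreath_int G)"
  using finsupp_mult[of "fst p" "\<lambda>i. fst q (i - snd p)"] finsupp_shift[of "fst q" G "- snd p"] assms
  by auto

text \<open>This pair is the inverse of \<open>p\<close>: solving
  \<open>q \<otimes> p = \<one>\<close> forces the integer \<open>- snd p\<close>, and shifting back
  by it turns index i into \<open>i + snd p\<close>.\<close>

lemma wreath_int_inverse_closed:
  assumes "p \<in> carrier (wreath_int G)"
  shows "(\<lambda>i. inv (fst p (i + snd p)), - snd p) \<in> carrier (wreath_int G)"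
  using finsupp_inv[OF finsupp_shift[of "fst p" G "snd p"]] assms by auto

lemma group_wreath_int: "group (wreath_int G)"
proof (rule groupI)
  fix p assume p: "p \<in> carrier (wreath_int G)"
  then have "(\<lambda>i. inv (fst p (i + snd p)), - snd p) \<otimes>\<^bsub>wreath_int G\<^esub> p = \<one>\<^bsub>wreath_int G\<^esub>"
    by (auto simp: finsupp_closed)
  with wreath_int_inverse_closed[OF p]
  show "\<exists>q\<in>carrier (wreath_int G). q \<otimes>\<^bsub>wreath_int G\<^esub> p = \<one>\<^bsub>wreath_int G\<^esub>"
    by blast
qed (use wreath_int_closed in
      \<open>auto simp: finsupp_one finsupp_closed m_assoc diff_diff_eq add.assoc\<close>)

lemma inv_wreath_int:
  assumes "p \<in> carrier (wreath_int G)"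
  shows "inv\<^bsub>wreath_int G\<^esub> p = (\<lambda>i. inv (fst p (i + snd p)), - snd p)"
proof (rule group.inv_equality[OF group_wreath_int])
  show "(\<lambda>i. inv (fst p (i + snd p)), - snd p) \<otimes>\<^bsub>wreath_int G\<^esub> p = \<one>\<^bsub>wreath_int G\<^esub>"
    using assms by (auto simp: finsupp_closed)
qed (use assms wreath_int_inverse_closed in auto)

text \<open>Both the normality of the base group and the cyclicity of its quotient are read off this
  projection.\<close>

lemma group_hom_wreath_int_snd: "group_hom (wreath_int G) integer_group snd"
  by (simp add: group_hom_def group_hom_axioms_def group_wreath_int hom_def)

lemma kernel_wreath_int_snd: "kernel (wreath_int G) integer_group snd = finsupp G \<times> {0}"
  by (auto simp: kernel_def)

text \<open>First isomorphism theorem for the projection onto the integers, which is onto because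
  every integer occurs next to the constant function \<open>\<one>\<close>.\<close>

lemma cyclic_wreath_int_quotient: "cyclic_group (wreath_int G Mod (finsupp G \<times> {0}))"
proof -
  interpret snd_hom: group_hom "wreath_int G" integer_group snd
    by (rule group_hom_wreath_int_snd)
  have "snd ` carrier (wreath_int G) = carrier integer_group"
    using finsupp_one by force
  then have "wreath_int G Mod (finsupp G \<times> {0}) \<cong> integer_group"
    using snd_hom.FactGroup_iso kernel_wreath_int_snd by metis
  moreover have "group (wreath_int G Mod (finsupp G \<times> {0}))"
    using normal.factorgroup_is_group[OF snd_hom.normal_kernel] kernel_wreath_int_snd by metis
  ultimately show ?thesis
    using isomorphic_group_cyclicity by fastforce
qed

end

section \<open>Continuity of multiplication and inversion\<close>

lemma continuous_map_discrete_parameter: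
  assumes g: "continuous_map X (discrete_topology UNIV) g"
    and F: "\<And>d. continuous_map X Y (F d)"
  shows "continuous_map X Y (\<lambda>x. F (g x) x)"
  unfolding continuous_map_def
proof (intro conjI allI impI)
  show "(\<lambda>x. F (g x) x) \<in> topspace X \<rightarrow> topspace Y"
    using F continuous_map_funspace by blast
next
  fix U assume "openin Y U"
  \<comment> \<open>Each fibre of \<open>g\<close> is open because the target of \<open>g\<close> is
    discrete, and on the fibre over d the map is \<open>F d\<close>. The preimage of
    \<open>U\<close> is the union of these pieces.\<close>
  then have "openin X ({x \<in> topspace X. g x \<in> {d}} \<inter> {x \<in> topspace X. F d x \<in> U})" for d
    by (intro openin_Int openin_continuous_map_preimage[OF g] openin_continuous_map_preimage[OF F])
      auto
  then have "openin X (\<Union>d. {x \<in> topspace X. g x \<in> {d}} \<inter> {x \<in> topspace X. F d x \<in> U})"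
    by blast
  also have "(\<Union>d. {x \<in> topspace X. g x \<in> {d}} \<inter> {x \<in> topspace X. F d x \<in> U})
      = {x \<in> topspace X. F (g x) x \<in> U}"
    by auto
  finally show "openin X {x \<in> topspace X. F (g x) x \<in> U}" .
qed

context topological_group
begin

lemma continuous_map_mult:
  assumes "continuous_map X T f" "continuous_map X T g"
  shows "continuous_map X T (\<lambda>x. f x \<otimes> g x)"
  using continuous_map_compose[OF _ continuous_mult, of X "\<lambda>x. (f x, g x)"] assms
  by (simp add: continuous_map_pairwise o_def)

lemma continuous_map_inv:
  assumes "continuous_map X T f"
  shows "continuous_map X T (\<lambda>x. inv (f x))"
  using continuous_map_compose[OF assms continuous_inv] by (simp add: o_def)

lemma topspace_wreath_int_topology:
  "topspace (wreath_int_topology G T) = carrier (wreath_int G)"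
  by (auto simp: wreath_int_topology_def topspace_eq_carrier finsupp_def)

text \<open>Universal properties of products and subspaces: continuity into the wreath product is a
  condition on each coordinate.\<close>

lemma continuous_map_into_wreath_int:
  "continuous_map X (wreath_int_topology G T) f \<longleftrightarrow>
     (\<forall>i. continuous_map X T (\<lambda>x. fst (f x) i)) \<and>
     continuous_map X (discrete_topology UNIV) (\<lambda>x. snd (f x)) \<and>
     (\<forall>x \<in> topspace X. fst (f x) \<in> finsupp G)"
  by (auto simp: wreath_int_topology_def continuous_map_pairwise continuous_map_in_subtopology
      continuous_map_componentwise_UNIV o_def)

lemma continuous_map_wreath_int_coord:
  assumes "continuous_map X (wreath_int_topology G T) f"
  shows "continuous_map X T (\<lambda>x. fst (f x) i)"
    and "continuous_map X (discrete_topology UNIV) (\<lambda>x. snd (f x))"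
  using assms by (auto simp: continuous_map_into_wreath_int)

lemma topological_group_wreath_int:
  "topological_group (wreath_int G) (wreath_int_topology G T)"
proof (intro topological_group.intro topological_group_axioms.intro group_wreath_int
    topspace_wreath_int_topology)
  let ?W = "wreath_int_topology G T"
  have fst: "continuous_map (prod_topology ?W ?W) T (\<lambda>p. fst (fst p) i)"
    and snd: "continuous_map (prod_topology ?W ?W) T (\<lambda>p. fst (snd p) i)"
    and fst': "continuous_map (prod_topology ?W ?W) (discrete_topology UNIV) (\<lambda>p. snd (fst p))"
    and snd': "continuous_map (prod_topology ?W ?W) (discrete_topology UNIV) (\<lambda>p. snd (snd p))" for i
    by (intro continuous_map_wreath_int_coord continuous_map_fst continuous_map_snd)+
  \<comment> \<open>The coordinate read from the second factor varies with the shift of the first.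
    Taking that shift as a discrete parameter leaves a fixed coordinate for each value.\<close>
  have "continuous_map (prod_topology ?W ?W) T
      (\<lambda>p. fst (fst p) i \<otimes> fst (snd p) (i - snd (fst p)))" for i
    by (rule continuous_map_discrete_parameter[OF fst',
          where F = "\<lambda>d p. fst (fst p) i \<otimes> fst (snd p) (i - d)"])
      (intro continuous_map_mult fst snd)
  moreover have "continuous_map (prod_topology ?W ?W) (discrete_topology UNIV)
      (\<lambda>p. snd (fst p) + snd (snd p))"
    by (rule continuous_map_discrete_parameter[OF fst',
          where F = "\<lambda>d p. d + snd (snd p)"])
      (use continuous_map_compose[OF snd', of "discrete_topology UNIV" "(+) d" for d] in
        \<open>simp add: o_def\<close>)
  moreover have "\<forall>p \<in> topspace (prod_topology ?W ?W).
      fst (fst p \<otimes>\<^bsub>wreath_int G\<^esub> snd p) \<in> finsupp G"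
    using wreath_int_closed by (fastforce simp: topspace_wreath_int_topology)
  ultimately show "continuous_map (prod_topology ?W ?W) ?W (\<lambda>(p, q). p \<otimes>\<^bsub>wreath_int G\<^esub> q)"
    by (simp add: continuous_map_into_wreath_int case_prod_beta)
  have fst: "continuous_map ?W T (\<lambda>p. fst p i)"
    and snd: "continuous_map ?W (discrete_topology UNIV) snd" for i
    using continuous_map_wreath_int_coord[OF continuous_map_id] by auto
  have "continuous_map ?W T (\<lambda>p. inv (fst p (i + snd p)))" for i
    by (rule continuous_map_discrete_parameter[OF snd, where F = "\<lambda>d p. inv (fst p (i + d))"])
      (intro continuous_map_inv fst)
  moreover have "continuous_map ?W (discrete_topology UNIV) (\<lambda>p. - snd p)"
    using continuous_map_compose[OF snd, of "discrete_topology UNIV" uminus] by (simp add: o_def)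
  \<comment> \<open>Continuity is proved for the explicit formula, which agrees with the group
    inverse on the carrier.\<close>
  ultimately have "continuous_map ?W ?W (\<lambda>p. (\<lambda>i. inv (fst p (i + snd p)), - snd p))"
    using wreath_int_inverse_closed
    by (simp add: continuous_map_into_wreath_int topspace_wreath_int_topology)
  then show "continuous_map ?W ?W (\<lambda>p. inv\<^bsub>wreath_int G\<^esub> p)"
    by (rule continuous_map_eq) (metis inv_wreath_int topspace_wreath_int_topology)
qed

section \<open>Duoseparability\<close>

lemma unit_neighborhood_wreath_int:
  assumes "unit_neighborhood (wreath_int G) (wreath_int_topology G T) U"
  obtains F where "finite F"
    "\<And>x. x \<in> finsupp G \<Longrightarrow> (\<And>i. i \<in> F \<Longrightarrow> x i = \<one>) \<Longrightarrow> (x, 0) \<in> U"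
proof -
  obtain W where W: "openin (wreath_int_topology G T) W" "(\<lambda>_. \<one>, 0) \<in> W" "W \<subseteq> U"
    using assms by (auto simp: unit_neighborhood_def interior_of_def)
  then obtain A B where A: "openin (subtopology (product_topology (\<lambda>_. T) UNIV) (finsupp G)) A"
    and AB: "(\<lambda>_. \<one>) \<in> A" "0 \<in> B" "A \<times> B \<subseteq> W"
    unfolding wreath_int_topology_def openin_prod_topology_alt by meson
  from A obtain A' where A': "openin (product_topology (\<lambda>_. T) UNIV) A'" "A = A' \<inter> finsupp G"
    by (auto simp: openin_subtopology)
  obtain V where V: "(\<lambda>_. \<one>) \<in> (\<Pi>\<^sub>E i\<in>UNIV. V i)" "finite {i. V i \<noteq> topspace T}"
    "(\<Pi>\<^sub>E i\<in>UNIV. V i) \<subseteq> A'"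
    using product_topology_open_contains_basis[OF A'(1)] AB(1) A'(2) by (metis IntD1)
  show thesis
  \<comment> \<open>\<open>F\<close> consists of the indices where the basic box \<open>V\<close>
    has a proper side. An element equal to \<open>\<one>\<close> there lies in the box, since
    \<open>\<one>\<close> is in every side and the other sides are all of
    \<open>topspace T\<close>.\<close>
  proof (rule that[OF V(2)])
    fix x assume x: "x \<in> finsupp G" "\<And>i. i \<in> {i. V i \<noteq> topspace T} \<Longrightarrow> x i = \<one>"
    have "x i \<in> V i" for i
      using x(2)[of i] finsupp_closed[OF x(1), of i] V(1)
      by (cases "V i = topspace T") (auto simp: topspace_eq_carrier PiE_iff)
    then have "x \<in> A"
      using V(3) A'(2) x(1) by auto
    then show "(x, 0) \<in> U"
      using AB W(3) by auto
  qed
qed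

lemma duoseparable_wreath_int: "duoseparable (wreath_int G) (wreath_int_topology G T)"
  unfolding duoseparable_def
proof (intro exI conjI allI impI)
  let ?K = "wreath_int G"
  let ?S = "{\<lambda>_. \<one>} \<times> (UNIV :: int set)"
  show S: "?S \<subseteq> carrier ?K"
    using finsupp_one by auto
  show "countable ?S"
    by auto
  fix U assume U: "unit_neighborhood ?K (wreath_int_topology G T) U"
  show "carrier ?K = ?S <#>\<^bsub>?K\<^esub> U <#>\<^bsub>?K\<^esub> ?S"
  proof
    have "U \<subseteq> carrier ?K"
      using U by (simp add: unit_neighborhood_def)
    with S show "?S <#>\<^bsub>?K\<^esub> U <#>\<^bsub>?K\<^esub> ?S \<subseteq> carrier ?K"
      by (intro monoid.set_mult_closed group.is_monoid group_wreath_int)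
  next
    obtain F where F: "finite F"
      "\<And>x. x \<in> finsupp G \<Longrightarrow> (\<And>i. i \<in> F \<Longrightarrow> x i = \<one>) \<Longrightarrow> (x, 0) \<in> U"
      using unit_neighborhood_wreath_int[OF U] by blast
    show "carrier ?K \<subseteq> ?S <#>\<^bsub>?K\<^esub> U <#>\<^bsub>?K\<^esub> ?S"
    proof
      fix p assume "p \<in> carrier ?K"
      then obtain x m where p: "p = (x, m)" and x: "x \<in> finsupp G"
        by auto
      \<comment> \<open>The shift n must move the support of x off \<open>F\<close>. The bad values
        are the differences j - i with j in the support and i in \<open>F\<close>, finitely many, so
        some integer avoids them.\<close>
      have "finite ((\<lambda>(j, i). j - i) ` ({j. x j \<noteq> \<one>} \<times> F))"
        using x F(1) by (auto simp: finsupp_def)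
      then obtain n where n: "n \<notin> (\<lambda>(j, i). j - i) ` ({j. x j \<noteq> \<one>} \<times> F)"
        using ex_new_if_finite[OF infinite_UNIV_int] by blast
      have "x (i + n) = \<one>" if "i \<in> F" for i
        using n that by force
      then have "(\<lambda>i. x (i + n), 0) \<in> U"
        using F(2) finsupp_shift[OF x] by blast
      \<comment> \<open>The left factor shifts the translated function back to x; the right factor
        corrects the integer from n to m.\<close>
      moreover have "p = ((\<lambda>_. \<one>, n) \<otimes>\<^bsub>?K\<^esub> (\<lambda>i. x (i + n), 0)) \<otimes>\<^bsub>?K\<^esub> (\<lambda>_. \<one>, m - n)"
        using finsupp_closed[OF x] by (simp add: p)
      ultimately show "p \<in> ?S <#>\<^bsub>?K\<^esub> U <#>\<^bsub>?K\<^esub> ?S"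
        unfolding set_mult_def by blast
    qed
  qed
qed

section \<open>The base group as closed normal abelian subgroup with cyclic quotient\<close>

lemma abelian_by_cyclic_wreath_int:
  assumes "comm_group G"
  shows "abelian_by_cyclic (wreath_int G) (wreath_int_topology G T)"
  unfolding abelian_by_cyclic_def
proof (intro exI conjI)
  interpret comm: comm_group G
    by (rule assms)
  let ?H = "finsupp G \<times> {0::int}"
  show normal: "?H \<lhd> wreath_int G"
    using group_hom.normal_kernel[OF group_hom_wreath_int_snd] kernel_wreath_int_snd by metis
  show "closedin (wreath_int_topology G T) ?H"
    \<comment> \<open>\<open>{0}\<close> is closed in the discrete integers, and
      \<open>finsupp G\<close> is closed in itself, being the trace of the whole product
      space.\<close>
    by (auto simp: wreath_int_topology_def closedin_prod_Times_iff closedin_subtopology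
        topspace_eq_carrier finsupp_def intro!: exI[of _ "topspace (product_topology (\<lambda>_. T) UNIV)"])
  \<comment> \<open>At shift 0 the product is coordinatewise, so commutativity passes from
    \<open>G\<close> to the base group.\<close>
  show "comm_group (wreath_int G\<lparr>carrier := ?H\<rparr>)"
    by (intro group.group_comm_groupI subgroup.subgroup_is_group[OF _ group_wreath_int]
        normal_imp_subgroup[OF normal])
      (auto simp: finsupp_closed comm.m_comm)
  show "cyclic_group (wreath_int G Mod ?H)"
    by (rule cyclic_wreath_int_quotient)
qed

section \<open>The copy of \<open>G\<close> in coordinate 0\<close>

definition wreath_int_coord :: "'a \<Rightarrow> (int \<Rightarrow> 'a) \<times> int" where
  "wreath_int_coord a = (\<lambda>i. if i = 0 then a else \<one>, 0)"

lemma group_hom_wreath_int_coord: "group_hom G (wreath_int G) wreath_int_coord"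
  by (auto simp: group_hom_def group_hom_axioms_def group_wreath_int hom_def wreath_int_coord_def
      finsupp_single)

lemma topologically_isomorphic_wreath_int_coord:
  fixes L defines "L \<equiv> wreath_int_coord ` carrier G"
  shows "topologically_isomorphic G T (wreath_int G\<lparr>carrier := L\<rparr>)
    (subtopology (wreath_int_topology G T) L)"
  unfolding topologically_isomorphic_def
proof (intro exI conjI)
  let ?W = "wreath_int_topology G T"
  have "inj_on wreath_int_coord (carrier G)"
    by (auto simp: inj_on_def wreath_int_coord_def dest: fun_cong[of _ _ 0])
  then show "wreath_int_coord \<in> iso G (wreath_int G\<lparr>carrier := L\<rparr>)"
    using group_hom.homh[OF group_hom_wreath_int_coord]
    by (auto simp: iso_def hom_def bij_betw_def L_def)
  \<comment> \<open>Each coordinate of the embedding is the identity or constant.\<close>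
  have "continuous_map T T (\<lambda>a. if i = (0::int) then a else \<one>)" for i
    using continuous_map_id[of T] by (cases "i = 0") (auto simp: id_def topspace_eq_carrier)
  then have "continuous_map T (subtopology ?W L) wreath_int_coord"
    by (auto simp: continuous_map_in_subtopology continuous_map_into_wreath_int L_def
        wreath_int_coord_def finsupp_single topspace_eq_carrier)
  \<comment> \<open>The inverse on the image is evaluation at coordinate 0, which is continuous on
    the whole wreath product.\<close>
  moreover have "continuous_map (subtopology ?W L) T (\<lambda>p. fst p 0)"
    using continuous_map_wreath_int_coord(1)[OF continuous_map_id, of 0]
    by (auto intro: continuous_map_from_subtopology)
  ultimately have "homeomorphic_maps T (subtopology ?W L) wreath_int_coord (\<lambda>p. fst p 0)"
    by (auto simp: homeomorphic_maps_def L_def wreath_int_coord_def)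
  then show "homeomorphic_map T (subtopology ?W L) wreath_int_coord"
    by (rule homeomorphic_maps_imp_map)
qed

end

theorem theorem3:
  fixes G :: "('a, 'b) monoid_scheme" and T :: "'a topology"
  assumes "topological_group G T" and "comm_group G"
  shows "\<exists>(K :: ((int \<Rightarrow> 'a) \<times> int) monoid) T' L.
    topological_group K T' \<and> duoseparable K T' \<and> abelian_by_cyclic K T' \<and>
    subgroup L K \<and>
    topologically_isomorphic G T (K\<lparr>carrier := L\<rparr>) (subtopology T' L)"
proof -
  interpret topological_group G T
    by (rule assms)
  have "subgroup (wreath_int_coord ` carrier G) (wreath_int G)"
    by (rule group_hom.img_is_subgroup[OF group_hom_wreath_int_coord])
  then show ?thesis
    using topological_group_wreath_int duoseparable_wreath_int
      abelian_by_cyclic_wreath_int[OF assms(2)] topologically_isomorphic_wreath_int_coord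
    by blast
qed

end
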